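(* Let $X$ be a chain and let $\alpha,\beta\in\mathcal{OP}(X)$. Then $\alpha\,\mathcal{R}\,\beta$ in $\mathcal{OP}(X)$ if and only if $\ker(\alpha)=\ker(\beta)$ and the canonical bijection $\phi:\mathrm{Im}(\alpha)\to\mathrm{Im}(\beta)$ is bicompletable in $\mathcal{OP}(X)$.
   Context: $X$ is a chain (totally ordered set), finite or infinite. Maps are written on the right and composed from left to right: $x(\alpha\beta)=(x\alpha)\beta$. A full transformation $\alpha:X\to X$ is orientation-preserving if it is the empty transformation (only when $X=\emptyset$) or there exists a non-empty subset $Y$ of $X$ such that: (OP1) $\alpha$ is order-preserving (i.e. $x\le y$ implies $x\alpha\le y\alpha$) both on $Y$ and on $X\setminus Y$; (OP2) for all $a\in Y$ and $b\in X\setminus Y$, $a\le b$ and $a\alpha\ge b\alpha$. $\mathcal{OP}(X)$ is the monoid, under composition, of all orientation-preserving full transformations of $X$. $\ker(\alpha)=\{(x,y)\in X\times X\mid x\alpha=y\alpha\}$. Green's relation $\mathcal{R}$ on a monoid $S$: $\alpha\,\mathcal{R}\,\beta$ iff $\alpha S=\beta S$. If $\ker(\alpha)=\ker(\beta)$, the canonical bijection $\phi:\mathrm{Im}(\alpha)\to\mathrm{Im}(\beta)$ is defined by: $a\phi=b$ iff $a\alpha^{-1}=b\beta^{-1}$ (equality of preimage sets), for $a\in\mathrm{Im}(\alpha)$, $b\in\mathrm{Im}(\beta)$; equivalently $a\phi=x\beta$ for any $x\in a\alpha^{-1}$. For $A,B\subseteq X$, a mapping $\theta:A\to B$ is completable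 in $\mathcal{OP}(X)$ if there exists $\gamma\in\mathcal{OP}(X)$ with $x\gamma=x\theta$ for all $x\in A$. A bijection $\theta:A\to B$ is bicompletable in $\mathcal{OP}(X)$ if both $\theta$ and its inverse $\theta^{-1}:B\to A$ are completable in $\mathcal{OP}(X)$. *)

theory Defs
  imports "HOL-Algebra.Coset" "HOL-Library.FuncSet"
begin

text \<open>A chain is a set \<open>X\<close> of elements of a linearly ordered type, carrying the induced order; it
  may be empty. Full transformations of \<open>X\<close> are the extensional functions \<open>X \<rightarrow>\<^sub>E X\<close>, so that
  equality of transformations is equality of functions.\<close>

definition orientation_preserving :: "'a::linorder set \<Rightarrow> ('a \<Rightarrow> 'a) \<Rightarrow> bool" where
  "orientation_preserving X \<alpha> \<longleftrightarrow>
     X = {} \<or>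
     (\<exists>Y. Y \<noteq> {} \<and> Y \<subseteq> X \<and>
        mono_on Y \<alpha> \<and> mono_on (X - Y) \<alpha> \<and>
        (\<forall>a\<in>Y. \<forall>b\<in>X - Y. a \<le> b \<and> \<alpha> a \<ge> \<alpha> b))"

text \<open>Maps act on the right: the product \<open>\<alpha>\<beta>\<close> is ``first \<open>\<alpha>\<close>, then \<open>\<beta>\<close>''.\<close>

definition OP :: "'a::linorder set \<Rightarrow> ('a \<Rightarrow> 'a) monoid" where
  "OP X = \<lparr>carrier = {\<alpha> \<in> X \<rightarrow>\<^sub>E X. orientation_preserving X \<alpha>},
           mult = (\<lambda>\<alpha> \<beta>. compose X \<beta> \<alpha>),
           one = (\<lambda>x\<in>X. x)\<rparr>"

text \<open>\<open>a <#\<^bsub>S\<^esub> carrier S\<close> is the principal right ideal \<open>aS\<close>.\<close>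

definition green_R :: "('a, 'b) monoid_scheme \<Rightarrow> 'a \<Rightarrow> 'a \<Rightarrow> bool" where
  "green_R S a b \<longleftrightarrow> a <#\<^bsub>S\<^esub> carrier S = b <#\<^bsub>S\<^esub> carrier S"

definition ker :: "'a set \<Rightarrow> ('a \<Rightarrow> 'b) \<Rightarrow> ('a \<times> 'a) set" where
  "ker X \<alpha> = {(x, y) \<in> X \<times> X. \<alpha> x = \<alpha> y}"

text \<open>The description is meaningful when \<open>ker X \<alpha> = ker X \<beta>\<close>; see \<open>canonical_bij_apply\<close>.\<close>

definition canonical_bij :: "'a set \<Rightarrow> ('a \<Rightarrow> 'b) \<Rightarrow> ('a \<Rightarrow> 'c) \<Rightarrow> 'b \<Rightarrow> 'c" where
  "canonical_bij X \<alpha> \<beta> =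
     (\<lambda>a\<in>\<alpha> ` X. THE b. b \<in> \<beta> ` X \<and> {x \<in> X. \<alpha> x = a} = {x \<in> X. \<beta> x = b})"

definition completable_OP :: "'a::linorder set \<Rightarrow> 'a set \<Rightarrow> 'a set \<Rightarrow> ('a \<Rightarrow> 'a) \<Rightarrow> bool" where
  "completable_OP X A B \<theta> \<longleftrightarrow>
     A \<subseteq> X \<and> B \<subseteq> X \<and> \<theta> \<in> A \<rightarrow> B \<and> (\<exists>\<gamma>\<in>carrier (OP X). \<forall>x\<in>A. \<gamma> x = \<theta> x)"

definition bicompletable_OP :: "'a::linorder set \<Rightarrow> 'a set \<Rightarrow> 'a set \<Rightarrow> ('a \<Rightarrow> 'a) \<Rightarrow> bool" where
  "bicompletable_OP X A B \<theta> \<longleftrightarrow>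
     bij_betw \<theta> A B \<and> completable_OP X A B \<theta> \<and> completable_OP X B A (inv_into A \<theta>)"

lemma canonical_bij_apply:
  assumes "ker X \<alpha> = ker X \<beta>" "x \<in> X"
  shows "canonical_bij X \<alpha> \<beta> (\<alpha> x) = \<beta> x"
proof -
  have k: "\<alpha> u = \<alpha> v \<longleftrightarrow> \<beta> u = \<beta> v" if "u \<in> X" "v \<in> X" for u v
    using assms(1) that unfolding ker_def by (auto simp: set_eq_iff)
  have "(THE b. b \<in> \<beta> ` X \<and> {u \<in> X. \<alpha> u = \<alpha> x} = {u \<in> X. \<beta> u = b}) = \<beta> x"
    using k assms(2) by (intro the_equality) auto
  then show ?thesis using assms(2) by (simp add: canonical_bij_def)
qed

lemma canonical_bij_bij_betw:
  assumes "ker X \<alpha> = ker X \<beta>"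
  shows "bij_betw (canonical_bij X \<alpha> \<beta>) (\<alpha> ` X) (\<beta> ` X)"
proof -
  have k: "\<alpha> u = \<alpha> v \<longleftrightarrow> \<beta> u = \<beta> v" if "u \<in> X" "v \<in> X" for u v
    using assms that unfolding ker_def by (auto simp: set_eq_iff)
  show ?thesis
    by (auto simp: bij_betw_def inj_on_def image_image canonical_bij_apply[OF assms] k)
qed

lemma orientation_preserving_compose:
  assumes "\<alpha> \<in> X \<rightarrow> X" "orientation_preserving X \<alpha>" "orientation_preserving X \<beta>"
  shows "orientation_preserving X (compose X \<beta> \<alpha>)"
proof (cases "X = {}")
  case False
  obtain Y where Y: "Y \<noteq> {}" "Y \<subseteq> X" "mono_on Y \<alpha>" "mono_on (X - Y) \<alpha>"
      "\<And>a b. a \<in> Y \<Longrightarrow> b \<in> X - Y \<Longrightarrow> a \<le> b \<and> \<alpha> b \<le> \<alpha> a"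
    using assms(2) False unfolding orientation_preserving_def by blast
  obtain Z where Z: "Z \<noteq> {}" "Z \<subseteq> X" "mono_on Z \<beta>" "mono_on (X - Z) \<beta>"
      "\<And>a b. a \<in> Z \<Longrightarrow> b \<in> X - Z \<Longrightarrow> a \<le> b \<and> \<beta> b \<le> \<beta> a"
    using assms(3) False unfolding orientation_preserving_def by blast
  have aX: "\<alpha> x \<in> X" if "x \<in> X" for x using assms(1) that by auto
  have up: "v \<in> X - Z" if "u \<in> X - Z" "u \<le> v" "v \<in> X" for u v
    using Z(5)[of v u] that by (metis Diff_iff order_antisym)
  have aY: "\<alpha> x \<le> \<alpha> y" if "x \<le> y" "x \<in> X" "y \<in> X" "x \<in> Y \<longleftrightarrow> y \<in> Y" for x y
    using Y(3,4) that by (cases "x \<in> Y") (auto simp: monotone_on_def)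
  have bZ: "\<beta> x \<le> \<beta> y" if "x \<le> y" "x \<in> X" "y \<in> X" "x \<in> Z \<longleftrightarrow> y \<in> Z" for x y
    using Z(3,4) that by (cases "x \<in> Z") (auto simp: monotone_on_def)
  have yx: "x \<in> Y" if "x \<le> y" "y \<in> Y" "x \<in> X" for x y
    using Y(5)[of y x] that by (metis Diff_iff order_antisym)
  show ?thesis
  proof (cases "\<exists>w\<in>X - Y. \<alpha> w \<notin> Z")
    case True
    then obtain w where w: "w \<in> X" "w \<notin> Y" "\<alpha> w \<notin> Z" by blast
    have YZ: "\<alpha> x \<notin> Z" if "x \<in> Y" for x
      using up[of "\<alpha> w" "\<alpha> x"] Y(5)[of x w] aX w that Y(2) by blast
    define W where "W = {x \<in> X. x \<in> Y \<or> \<alpha> x \<in> Z}"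
    have "W \<noteq> {}" "W \<subseteq> X" using Y(1,2) unfolding W_def by auto
    moreover have "mono_on W (compose X \<beta> \<alpha>)"
      unfolding monotone_on_def
    proof (intro ballI allI impI)
      fix x y assume xy: "x \<in> W" "y \<in> W" "x \<le> y"
      then have X: "x \<in> X" "y \<in> X" by (auto simp: W_def)
      have "\<beta> (\<alpha> x) \<le> \<beta> (\<alpha> y)"
      proof (cases "x \<in> Y \<longleftrightarrow> y \<in> Y")
        case True
        then show ?thesis using xy X bZ[of "\<alpha> x" "\<alpha> y"] aY[of x y] aX YZ W_def by blast
      next
        case False
        then have "x \<in> Y" "y \<notin> Y" using yx xy X by blast+
        then show ?thesis using xy X Z(5)[of "\<alpha> y" "\<alpha> x"] YZ aX W_def by blast
      qed
      then show "compose X \<beta> \<alpha> x \<le> compose X \<beta> \<alpha> y" using X by (simp add: compose_eq)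
    qed
    moreover have "mono_on (X - W) (compose X \<beta> \<alpha>)"
      using bZ aY aX by (auto simp: monotone_on_def compose_eq W_def)
    moreover have "a \<le> b \<and> compose X \<beta> \<alpha> b \<le> compose X \<beta> \<alpha> a" if ab: "a \<in> W" "b \<in> X - W" for a b
    proof -
      have X: "a \<in> X" "b \<in> X" "b \<notin> Y" "\<alpha> b \<notin> Z" using ab by (auto simp: W_def)
      have "a \<le> b \<and> \<beta> (\<alpha> b) \<le> \<beta> (\<alpha> a)"
      proof (cases "a \<in> Y")
        case True
        then show ?thesis using X Y(5)[of a b] bZ[of "\<alpha> b" "\<alpha> a"] YZ aX by blast
      next
        case False
        then have aZ: "\<alpha> a \<in> Z" using ab by (auto simp: W_def)
        have "a \<le> b"
        proof (rule ccontr)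
          assume "\<not> a \<le> b"
          then have "\<alpha> b \<le> \<alpha> a" using aY[of b a] X False by auto
          then show False using up[of "\<alpha> b" "\<alpha> a"] aX X aZ by blast
        qed
        then show ?thesis using Z(5)[of "\<alpha> a" "\<alpha> b"] aZ X aX by blast
      qed
      then show ?thesis using X by (simp add: compose_eq)
    qed
    ultimately show ?thesis unfolding orientation_preserving_def by blast
  next
    case F: False
    define W where "W = {x \<in> Y. \<alpha> x \<in> Z}"
    have W: "W \<subseteq> X" "mono_on W (compose X \<beta> \<alpha>)"
      using Y(2) bZ aY aX by (auto simp: monotone_on_def compose_eq W_def subset_iff)
    have V: "mono_on (X - W) (compose X \<beta> \<alpha>)"
      unfolding monotone_on_def
    proof (intro ballI allI impI)
      fix x y assume xy: "x \<in> X - W" "y \<in> X - W" "x \<le> y"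
      have "\<beta> (\<alpha> x) \<le> \<beta> (\<alpha> y)"
      proof (cases "x \<in> Y \<longleftrightarrow> y \<in> Y")
        case True
        then show ?thesis using xy bZ[of "\<alpha> x" "\<alpha> y"] aY[of x y] aX F W_def by blast
      next
        case False
        then have "x \<in> Y" "y \<notin> Y" using yx xy by blast+
        then show ?thesis using xy Z(5)[of "\<alpha> y" "\<alpha> x"] F aX W_def by blast
      qed
      then show "compose X \<beta> \<alpha> x \<le> compose X \<beta> \<alpha> y" using xy by (simp add: compose_eq)
    qed
    have C: "a \<le> b \<and> compose X \<beta> \<alpha> b \<le> compose X \<beta> \<alpha> a" if ab: "a \<in> W" "b \<in> X - W" for a b
    proof -
      have X: "a \<in> Y" "a \<in> X" "b \<in> X" "\<alpha> a \<in> Z" using ab Y(2) by (auto simp: W_def)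
      have "a \<le> b \<and> \<beta> (\<alpha> b) \<le> \<beta> (\<alpha> a)"
      proof (cases "b \<in> Y")
        case True
        then have bZ': "\<alpha> b \<notin> Z" using ab by (auto simp: W_def)
        have "a \<le> b"
        proof (rule ccontr)
          assume "\<not> a \<le> b"
          then have "\<alpha> b \<le> \<alpha> a" using aY[of b a] X True by auto
          then show False using up[of "\<alpha> b" "\<alpha> a"] aX X bZ' by blast
        qed
        then show ?thesis using Z(5)[of "\<alpha> a" "\<alpha> b"] bZ' X aX by blast
      next
        case False
        then show ?thesis using X Y(5)[of a b] bZ[of "\<alpha> b" "\<alpha> a"] F aX by blast
      qed
      then show ?thesis using X by (simp add: compose_eq)
    qed
    show ?thesis
    proof (cases "W = {}")
      case True
      then show ?thesis using V False unfolding orientation_preserving_def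
        by (intro disjI2 exI[of _ X]) (auto simp: monotone_on_def)
    next
      case False
      then show ?thesis using W V C unfolding orientation_preserving_def by blast
    qed
  qed
qed (simp add: orientation_preserving_def)

lemma monoid_OP: "monoid (OP X)"
proof (rule monoidI)
  show "\<one>\<^bsub>OP X\<^esub> \<in> carrier (OP X)"
    unfolding OP_def orientation_preserving_def
    by (cases "X = {}") (auto simp: monotone_on_def intro!: exI[of _ X])
  show "\<alpha> \<otimes>\<^bsub>OP X\<^esub> \<beta> \<in> carrier (OP X)"
    if "\<alpha> \<in> carrier (OP X)" "\<beta> \<in> carrier (OP X)" for \<alpha> \<beta>
  proof -
    have "compose X \<beta> \<alpha> \<in> X \<rightarrow>\<^sub>E X"
      using that by (auto simp: OP_def compose_def PiE_iff)
    moreover have "orientation_preserving X (compose X \<beta> \<alpha>)"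
      using that by (intro orientation_preserving_compose) (auto simp: OP_def)
    ultimately show ?thesis by (simp add: OP_def)
  qed
  show "(\<alpha> \<otimes>\<^bsub>OP X\<^esub> \<beta>) \<otimes>\<^bsub>OP X\<^esub> \<gamma> = \<alpha> \<otimes>\<^bsub>OP X\<^esub> (\<beta> \<otimes>\<^bsub>OP X\<^esub> \<gamma>)"
    if "\<alpha> \<in> carrier (OP X)" for \<alpha> \<beta> \<gamma>
    using that by (auto simp: OP_def compose_def fun_eq_iff)
  show "\<one>\<^bsub>OP X\<^esub> \<otimes>\<^bsub>OP X\<^esub> \<alpha> = \<alpha>" "\<alpha> \<otimes>\<^bsub>OP X\<^esub> \<one>\<^bsub>OP X\<^esub> = \<alpha>" if "\<alpha> \<in> carrier (OP X)" for \<alpha>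
    using that by (auto simp: OP_def compose_def fun_eq_iff PiE_iff extensional_def)
qed

end

theory Submission
  imports Defs
begin

text \<open>
  In any monoid, \<open>a\<close> and \<open>b\<close> generate the same principal right ideal iff each is a right
  multiple of the other.  In \<open>OP X\<close>, the equation \<open>\<beta> = \<alpha>\<gamma>\<close> says that \<open>\<gamma>\<close> sends
  \<open>\<alpha> x\<close> to \<open>\<beta> x\<close> for every \<open>x \<in> X\<close>.  Such a \<open>\<gamma>\<close> forces \<open>ker X \<alpha> \<subseteq> ker X \<beta>\<close>, so
  mutual factorization gives equal kernels.  Once the kernels are equal, \<open>\<alpha> x \<mapsto> \<beta> x\<close> is
  the canonical bijection, and \<open>\<gamma>\<close> is nothing but a completion of it
  (\<open>completable_canonical_bij_iff\<close>); exchanging \<open>\<alpha>\<close> and \<open>\<beta>\<close> replaces the canonical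
  bijection by its inverse (\<open>inv_into_canonical_bij\<close>).  Thus the two factorizations are
  exactly the two halves of bicompletability.
\<close>

lemma (in monoid) l_coset_carrier_subset_iff:
  assumes "a \<in> carrier G" "b \<in> carrier G"
  shows "a <# carrier G \<subseteq> b <# carrier G \<longleftrightarrow> (\<exists>c\<in>carrier G. a = b \<otimes> c)"
proof
  assume "a <# carrier G \<subseteq> b <# carrier G"
  moreover have "a \<in> a <# carrier G"
    using r_one[OF assms(1)] by (auto simp: l_coset_def intro!: bexI[of _ \<one>])
  ultimately show "\<exists>c\<in>carrier G. a = b \<otimes> c"
    by (auto simp: l_coset_def)
next
  assume "\<exists>c\<in>carrier G. a = b \<otimes> c"
  then obtain c where "c \<in> carrier G" "a = b \<otimes> c" by blast
  then show "a <# carrier G \<subseteq> b <# carrier G"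
    using assms(2) by (auto simp: l_coset_def m_assoc)
qed

lemma OP_eq_mult_iff:
  assumes "\<beta> \<in> carrier (OP X)"
  shows "\<beta> = \<alpha> \<otimes>\<^bsub>OP X\<^esub> \<gamma> \<longleftrightarrow> (\<forall>x\<in>X. \<gamma> (\<alpha> x) = \<beta> x)"
  using assms by (auto simp: OP_def compose_def fun_eq_iff PiE_iff extensional_def)

lemma green_R_OP_iff:
  assumes "\<alpha> \<in> carrier (OP X)" "\<beta> \<in> carrier (OP X)"
  shows "green_R (OP X) \<alpha> \<beta> \<longleftrightarrow>
    (\<exists>\<gamma>\<in>carrier (OP X). \<forall>x\<in>X. \<gamma> (\<alpha> x) = \<beta> x) \<and>
    (\<exists>\<delta>\<in>carrier (OP X). \<forall>x\<in>X. \<delta> (\<beta> x) = \<alpha> x)"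
proof -
  interpret monoid "OP X" by (rule monoid_OP)
  show ?thesis
    unfolding green_R_def set_eq_subset
    by (simp add: l_coset_carrier_subset_iff OP_eq_mult_iff assms conj_commute)
qed

lemma ker_subset_if_factor:
  assumes "\<And>x. x \<in> X \<Longrightarrow> \<gamma> (\<alpha> x) = \<beta> x"
  shows "ker X \<alpha> \<subseteq> ker X \<beta>"
proof -
  have "\<beta> x = \<beta> y" if "x \<in> X" "y \<in> X" "\<alpha> x = \<alpha> y" for x y
    using assms[of x] assms[of y] that by simp
  then show ?thesis by (auto simp: ker_def)
qed

text \<open>
  Every point of \<open>\<alpha> ` X\<close> has the form \<open>\<alpha> x\<close>, and the canonical bijection takes it to
  \<open>\<beta> x\<close>; so agreeing with the bijection on \<open>\<alpha> ` X\<close> is the same condition as the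
  factorization \<open>\<beta> = \<alpha>\<gamma>\<close>.
\<close>

lemma completable_canonical_bij_iff:
  assumes "ker X \<alpha> = ker X \<beta>" "\<alpha> ` X \<subseteq> X" "\<beta> ` X \<subseteq> X"
  shows "completable_OP X (\<alpha> ` X) (\<beta> ` X) (canonical_bij X \<alpha> \<beta>) \<longleftrightarrow>
    (\<exists>\<gamma>\<in>carrier (OP X). \<forall>x\<in>X. \<gamma> (\<alpha> x) = \<beta> x)"
  using assms(2,3) bij_betw_imp_funcset[OF canonical_bij_bij_betw[OF assms(1)]]
  by (simp add: completable_OP_def canonical_bij_apply[OF assms(1)])

lemma inv_into_canonical_bij:
  assumes "ker X \<alpha> = ker X \<beta>" "b \<in> \<beta> ` X"
  shows "inv_into (\<alpha> ` X) (canonical_bij X \<alpha> \<beta>) b = canonical_bij X \<beta> \<alpha> b"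
proof -
  obtain x where x: "x \<in> X" "b = \<beta> x" using assms(2) by blast
  have "inv_into (\<alpha> ` X) (canonical_bij X \<alpha> \<beta>) (canonical_bij X \<alpha> \<beta> (\<alpha> x)) = \<alpha> x"
    using bij_betw_imp_inj_on[OF canonical_bij_bij_betw[OF assms(1)]] x(1)
    by (intro inv_into_f_f) auto
  then show ?thesis
    using x by (simp add: canonical_bij_apply assms(1))
qed

lemma completable_OP_cong:
  assumes "\<And>a. a \<in> A \<Longrightarrow> \<theta> a = \<eta> a"
  shows "completable_OP X A B \<theta> \<longleftrightarrow> completable_OP X A B \<eta>"
  using assms by (simp add: completable_OP_def Pi_def)

theorem theorem4p5:
  fixes X :: "'a::linorder set" and \<alpha> \<beta> :: "'a \<Rightarrow> 'a"
  assumes "\<alpha> \<in> carrier (OP X)" and "\<beta> \<in> carrier (OP X)"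
  shows "green_R (OP X) \<alpha> \<beta> \<longleftrightarrow>
    ker X \<alpha> = ker X \<beta> \<and>
    bicompletable_OP X (\<alpha> ` X) (\<beta> ` X) (canonical_bij X \<alpha> \<beta>)"
proof -
  have im: "\<alpha> ` X \<subseteq> X" "\<beta> ` X \<subseteq> X"
    using assms by (auto simp: OP_def)
  have bicompletable: "bicompletable_OP X (\<alpha> ` X) (\<beta> ` X) (canonical_bij X \<alpha> \<beta>) \<longleftrightarrow>
      green_R (OP X) \<alpha> \<beta>" if k: "ker X \<alpha> = ker X \<beta>"
  proof -
    have "completable_OP X (\<beta> ` X) (\<alpha> ` X) (inv_into (\<alpha> ` X) (canonical_bij X \<alpha> \<beta>)) \<longleftrightarrow>
        completable_OP X (\<beta> ` X) (\<alpha> ` X) (canonical_bij X \<beta> \<alpha>)"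
      by (intro completable_OP_cong inv_into_canonical_bij[OF k])
    then show ?thesis
      by (simp add: bicompletable_OP_def canonical_bij_bij_betw[OF k] green_R_OP_iff[OF assms]
          completable_canonical_bij_iff[OF k im]
          completable_canonical_bij_iff[OF k[symmetric] im(2,1)])
  qed
  have "ker X \<alpha> = ker X \<beta>" if "green_R (OP X) \<alpha> \<beta>"
    using that ker_subset_if_factor[of X _ \<alpha> \<beta>] ker_subset_if_factor[of X _ \<beta> \<alpha>]
    unfolding green_R_OP_iff[OF assms] by blast
  with bicompletable show ?thesis by blast
qed

end
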